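(* If $\mu_1,\mu_2$ are probability measures on the unit circle $\mathbb T$, then there exists a unique probability measure $\mu$ on $\mathbb T$ such that $$\eta_\mu(z)=\frac{z\,\eta_{\mu_1}(\eta_{\mu_2}(z))}{\eta_{\mu_2}(z)}$$ for all $z$ in the open unit disc $\mathbb D$, where we understand that $\eta_{\mu_1}(0)/0=\eta_{\mu_1}'(0)$.
   Context: For a probability measure $\mu$ on $\mathbb T=\{z\in\mathbb C:|z|=1\}$, $\psi_\mu(z)=\int_{\mathbb T}\frac{zt}{1-zt}\,d\mu(t)$ and $\eta_\mu(z)=\frac{\psi_\mu(z)}{1+\psi_\mu(z)}$ for $z\in\mathbb D=\{z\in\mathbb C:|z|<1\}$. (The measure $\mu$ is called the orthogonal multiplicative convolution $\mu_1\angle\mu_2$.) *)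

theory Defs
  imports "HOL-Probability.Probability" "HOL-Complex_Analysis.Complex_Analysis"
begin

definition circle_prob :: "complex measure \<Rightarrow> bool" where
  "circle_prob \<mu> \<longleftrightarrow>
     prob_space \<mu> \<and> sets \<mu> = sets (restrict_space borel (sphere 0 1))"

definition psi :: "complex measure \<Rightarrow> complex \<Rightarrow> complex" where
  "psi \<mu> z = (LINT t|\<mu>. z * t / (1 - z * t))"

definition eta :: "complex measure \<Rightarrow> complex \<Rightarrow> complex" where
  "eta \<mu> z = psi \<mu> z / (1 + psi \<mu> z)"

text \<open>
  The quotient \<open>\<eta>\<^sub>\<mu>(w) / w\<close> under the convention \<open>\<eta>\<^sub>\<mu>(0) / 0 = \<eta>\<^sub>\<mu>'(0)\<close>. In the convolution
  equation \<open>w\<close> is a value of another \<open>\<eta>\<close>-function, which can vanish at points other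
  than \<open>0\<close> (or identically), so the convention matters at each of its zeros.
\<close>

definition eta_quot :: "complex measure \<Rightarrow> complex \<Rightarrow> complex" where
  "eta_quot \<mu> w = (if w = 0 then deriv (eta \<mu>) 0 else eta \<mu> w / w)"

end

theory Submission
  imports Defs "HOL-Real_Asymp.Real_Asymp"
begin

text \<open>
  Since \<open>Re \<psi>\<^sub>\<mu> > - 1/2\<close> on the disc, \<open>\<eta>\<^sub>\<mu>\<close> is a holomorphic self-map of the disc fixing \<open>0\<close>, and
  by the Schwarz lemma so is \<open>F z = z \<eta>\<^sub>\<mu>\<^sub>1 (\<eta>\<^sub>\<mu>\<^sub>2 z) / \<eta>\<^sub>\<mu>\<^sub>2 z\<close>. Conversely, every such \<open>F\<close> is \<open>\<eta>\<^sub>\<mu>\<close> for exactly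
  one \<open>\<mu>\<close>: \<open>g = (1 + F) / (1 - F)\<close> has nonnegative real part and \<open>g 0 = 1\<close>, so the densities
  \<open>Re g (r / t)\<close> are probability densities on the circle, and a weak limit as \<open>r \<longrightarrow> 1\<close> has
  the required moments, which are the coefficients of \<open>1 + \<psi>\<^sub>\<mu> = (1 + g) / 2\<close>. Moments determine
  the measure by the Stone-Weierstrass theorem.
\<close>

section \<open>Circle measures: moments, \<open>psi\<close>, \<open>eta\<close> and
  \<open>eta_quot\<close>\<close>

locale circle_measure = prob_space M for M :: "complex measure" +
  assumes sets_circle [measurable_cong]: "sets M = sets (restrict_space borel (sphere 0 1))"

lemma circle_prob_iff: "circle_prob \<mu> \<longleftrightarrow> circle_measure \<mu>"
  by (simp add: circle_prob_def circle_measure_def circle_measure_axioms_def)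

lemma circle_denominator:
  fixes z t :: complex
  assumes "z \<in> ball 0 1" "t \<in> sphere 0 1"
  shows "norm (z * t) < 1" "1 - z * t \<noteq> 0"
proof -
  show *: "norm (z * t) < 1" using assms by (simp add: norm_mult)
  then show "1 - z * t \<noteq> 0" by auto
qed

context circle_measure
begin

lemma space_circle [simp]: "space M = sphere 0 1"
  using sets_eq_imp_space_eq[OF sets_circle] by (simp add: space_restrict_space)

lemma borel_measurable_circle:
  "continuous_on (sphere 0 1) f \<Longrightarrow> f \<in> borel_measurable M"
  using borel_measurable_continuous_on_restrict measurable_cong_sets[OF sets_circle refl] by blast

lemma integrable_circle:
  fixes f :: "complex \<Rightarrow> 'b::{banach, second_countable_topology}"
  assumes "continuous_on (sphere 0 1) f"
  shows "integrable M f"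
proof -
  have "compact (f ` sphere 0 1)"
    by (intro compact_continuous_image assms) auto
  then obtain B where "\<forall>x\<in>f ` sphere 0 1. norm x \<le> B"
    using compact_imp_bounded bounded_iff by metis
  then show ?thesis
    by (intro integrable_const_bound[where B=B] borel_measurable_circle assms AE_I2) auto
qed

lemma psi_plus_1:
  assumes z: "z \<in> ball 0 1"
  shows "1 + psi M z = (LINT t|M. 1 / (1 - z * t))"
proof -
  have "(LINT t|M. 1 / (1 - z * t)) = (LINT t|M. 1 + z * t / (1 - z * t))"
    by (intro Bochner_Integration.integral_cong refl)
       (use circle_denominator(2)[OF z] in \<open>auto simp: field_simps\<close>)
  also have "\<dots> = 1 + psi M z"
    unfolding psi_def
    by (subst Bochner_Integration.integral_add)
       (use circle_denominator(2)[OF z] in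
         \<open>auto intro!: integrable_circle continuous_intros simp: prob_space[simplified]\<close>)
  finally show ?thesis ..
qed

text \<open>Expand 1 / (1 - z t) as a geometric series. The norms of its terms integrate to |z|^n,
  which is summable, so sum and integral may be exchanged.\<close>

lemma moment_series_sums:
  assumes z: "z \<in> ball 0 1"
  shows "(\<lambda>n. (LINT t|M. t ^ n) * z ^ n) sums (1 + psi M z)"
proof -
  have int: "integrable M (\<lambda>t. (z * t) ^ n)" for n
    by (intro integrable_circle continuous_intros)
  have nrm: "(LINT t|M. norm ((z * t) ^ n)) = norm z ^ n" for n
  proof -
    have "(LINT t|M. norm ((z * t) ^ n)) = (LINT t|M. norm z ^ n)"
      by (intro Bochner_Integration.integral_cong refl) (auto simp: norm_power norm_mult)
    then show ?thesis by (simp add: prob_space[simplified])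
  qed
  have 1: "AE t in M. summable (\<lambda>n. norm ((z * t) ^ n))"
    by (rule AE_I2) (use circle_denominator(1)[OF z] in \<open>auto simp: norm_power\<close>)
  have 2: "summable (\<lambda>n. LINT t|M. norm ((z * t) ^ n))"
    unfolding nrm using z by auto
  have "(\<lambda>n. LINT t|M. (z * t) ^ n) sums (\<Sum>n. LINT t|M. (z * t) ^ n)"
    using summable_integral[OF int 1 2] by (rule summable_sums)
  also have "(\<Sum>n. LINT t|M. (z * t) ^ n) = (LINT t|M. (\<Sum>n. (z * t) ^ n))"
    using integral_suminf[OF int 1 2] ..
  also have "\<dots> = (LINT t|M. 1 / (1 - z * t))"
    by (intro Bochner_Integration.integral_cong refl suminf_geometric)
       (use circle_denominator(1)[OF z] in auto)
  finally show ?thesis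
    by (simp add: psi_plus_1[OF z] power_mult_distrib mult.commute)
qed

lemma psi_holomorphic: "psi M holomorphic_on ball 0 1"
proof -
  have "(\<lambda>z. 1 + psi M z) holomorphic_on ball 0 1"
    using moment_series_sums by (intro power_series_holomorphic) simp
  from holomorphic_on_diff[OF this holomorphic_on_const[of 1]] show ?thesis by simp
qed

text \<open>The map w -> 1 / (1 - w) sends the disc into the half-plane Re > 1/2, and averaging over
  a probability measure preserves the strict bound.\<close>

lemma Re_psi:
  assumes z: "z \<in> ball 0 1"
  shows "- 1 / 2 < Re (psi M z)"
proof -
  have int: "integrable M (\<lambda>t. 1 / (1 - z * t))"
    by (intro integrable_circle continuous_intros) (use circle_denominator(2)[OF z] in auto)
  have *: "1 / 2 < Re (1 / (1 - w))" if "norm w < 1" for w :: complex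
  proof -
    have "(Re w)\<^sup>2 + (Im w)\<^sup>2 < 1"
      using that by (metis cmod_power2 norm_ge_zero one_power2 power_strict_mono zero_less_numeral)
    moreover have "0 < (1 - Re w)\<^sup>2 + (Im w)\<^sup>2"
      using that by (metis abs_Re_le_cmod add_pos_nonneg diff_gt_0_iff_gt le_less_trans
          abs_le_D1 zero_le_power2 zero_less_power)
    ultimately show ?thesis
      by (simp add: Re_divide divide_simps power2_eq_square algebra_simps)
  qed
  have "1 / 2 < (LINT t|M. Re (1 / (1 - z * t)))"
    by (intro expectation_greater integrable_Re int AE_I2 *) (use circle_denominator(1)[OF z] in auto)
  also have "\<dots> = Re (1 + psi M z)"
    unfolding psi_plus_1[OF z] using int by (rule integral_Re)
  finally show ?thesis by simp
qed

lemma psi_plus_1_nonzero: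
  assumes "z \<in> ball 0 1"
  shows "1 + psi M z \<noteq> 0"
proof
  assume "1 + psi M z = 0"
  then have "Re (1 + psi M z) = 0" by simp
  with Re_psi[OF assms] show False by simp
qed

lemma psi_0 [simp]: "psi M 0 = 0" and eta_0 [simp]: "eta M 0 = 0"
  by (simp_all add: psi_def eta_def)

lemma eta_holomorphic: "eta M holomorphic_on ball 0 1"
  unfolding eta_def[abs_def]
  by (intro holomorphic_intros psi_holomorphic psi_plus_1_nonzero)

text \<open>By \<open>Re_psi\<close>, the value of \<open>psi\<close> lies strictly closer to 0 than
  to -1.\<close>

lemma norm_eta_less_1:
  assumes "z \<in> ball 0 1"
  shows "norm (eta M z) < 1"
proof -
  have "(norm (psi M z))\<^sup>2 < (norm (1 + psi M z))\<^sup>2"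
    using Re_psi[OF assms] unfolding cmod_power2 by (simp add: power2_eq_square algebra_simps)
  then have "norm (psi M z) < norm (1 + psi M z)"
    using norm_ge_zero power_less_imp_less_base by blast
  then show ?thesis
    by (simp add: eta_def norm_divide divide_simps)
qed

lemma psi_eq_eta:
  assumes "z \<in> ball 0 1"
  shows "psi M z = eta M z / (1 - eta M z)"
  using psi_plus_1_nonzero[OF assms] by (simp add: eta_def divide_simps)

text \<open>The singularity at 0 is removable because \<open>eta\<close> vanishes there; the
  derivative is the value that fills it.\<close>

lemma eta_quot_holomorphic: "eta_quot M holomorphic_on ball 0 1"
proof -
  have "eta_quot M = (\<lambda>z. if z = 0 then deriv (eta M) 0 else (eta M z - eta M 0) / (z - 0))"
    by (auto simp: eta_quot_def fun_eq_iff)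
  then show ?thesis
    using pole_lemma[OF eta_holomorphic, of 0] by simp
qed

text \<open>Both branches are the Schwarz lemma: its bound on the function for w \<noteq> 0, its
  bound on the derivative at 0. Point masses attain equality.\<close>

lemma norm_eta_quot_le_1:
  assumes "w \<in> ball 0 1"
  shows "norm (eta_quot M w) \<le> 1"
  using Schwarz_Lemma(1,2)[OF eta_holomorphic eta_0 norm_eta_less_1, of w] assms
  by (auto simp: eta_quot_def norm_divide divide_simps)

end

section \<open>Uniqueness: moments, and hence \<open>eta\<close>, determine the measure\<close>

text \<open>Agreement is extended step by step: from powers to real polynomials in Re t and Im t, to
  continuous functions by uniform approximation, to closed sets by limits, and to all Borel sets by
  generation.\<close>

lemma circle_measure_eqI:
  assumes "circle_measure \<mu>" "circle_measure \<nu>"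
    and moments: "\<And>n. (LINT t|\<mu>. t ^ n) = (LINT t|\<nu>. t ^ n)"
  shows "\<mu> = \<nu>"
proof -
  interpret \<mu>: circle_measure \<mu> by fact
  interpret \<nu>: circle_measure \<nu> by fact
  \<comment> \<open>Asking for all \<open>k\<close> makes \<open>A\<close> closed under multiplication by \<open>Re t\<close> and \<open>Im t\<close>, which are
    combinations of \<open>t\<close> and \<open>1 / t\<close> on the circle.\<close>
  define A where "A = {f :: complex \<Rightarrow> complex. continuous_on (sphere 0 1) f \<and>
      (\<forall>k::int. (LINT t|\<mu>. t powi k * f t) = (LINT t|\<nu>. t powi k * f t))}"
  have int_powi: "integrable \<mu> (\<lambda>t. t powi k * f t)" "integrable \<nu> (\<lambda>t. t powi k * f t)"
    if "continuous_on (sphere 0 1) f" for f :: "complex \<Rightarrow> complex" and k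
    by (intro \<mu>.integrable_circle \<nu>.integrable_circle continuous_intros that; auto)+
  have cnj_inverse: "cnj t = inverse t" if "norm t = 1" for t :: complex
    using that complex_norm_square[of t] by (intro inverse_unique[symmetric]) simp
  \<comment> \<open>On the circle a negative power is the conjugate of a positive one, so moments of
    negative order agree as well.\<close>
  have moments_powi: "(LINT t|\<mu>. t powi k) = (LINT t|\<nu>. t powi k)" for k
  proof (cases "k \<ge> 0")
    case True
    then show ?thesis using moments[of "nat k"] by (simp add: power_int_def)
  next
    case False
    have "t powi k = cnj (t ^ nat (- k))" if "t \<in> sphere 0 1" for t :: complex
      using that False by (simp add: power_int_def cnj_inverse power_inverse)
    then have "(LINT t|N. t powi k) = (LINT t|N. cnj (t ^ nat (- k)))" if "circle_measure N" for N
      using that by (intro Bochner_Integration.integral_cong refl)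
        (simp only: circle_measure.space_circle)
    with assms(1,2) show ?thesis
      by (simp only: Bochner_Integration.integral_cnj moments)
  qed
  have A_add: "(\<lambda>t. f t + g t) \<in> A" if "f \<in> A" "g \<in> A" for f g
    using that int_powi by (auto simp: A_def distrib_left intro!: continuous_intros)
  have A_scale: "(\<lambda>t. c * f t) \<in> A" if "f \<in> A" for f c
  proof -
    have "(LINT t|N. t powi k * (c * f t)) = c * (LINT t|N. t powi k * f t)" for k N
      by (simp only: mult.left_commute[of _ c] integral_mult_right_zero)
    then show ?thesis using that by (auto simp: A_def intro!: continuous_intros)
  qed
  have A_shift: "(\<lambda>t. t powi j * f t) \<in> A" if "f \<in> A" for f j
  proof -
    have "(LINT t|N. t powi k * (t powi j * f t)) = (LINT t|N. t powi (k + j) * f t)"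
      if "circle_measure N" for N k
    proof (intro Bochner_Integration.integral_cong refl)
      fix t assume "t \<in> space N"
      then have "t \<noteq> 0" using that by (auto simp: circle_measure.space_circle)
      then show "t powi k * (t powi j * f t) = t powi (k + j) * f t"
        by (simp add: power_int_add)
    qed
    with that assms(1,2) show ?thesis
      by (auto simp: A_def intro!: continuous_intros)
  qed
  have A_cong: "f \<in> A" if "g \<in> A" "\<And>t. t \<in> sphere 0 1 \<Longrightarrow> f t = g t" for f g
  proof -
    have "(LINT t|N. t powi k * f t) = (LINT t|N. t powi k * g t)" if "circle_measure N" for N k
      using that \<open>\<And>t. t \<in> sphere 0 1 \<Longrightarrow> f t = g t\<close>
      by (intro Bochner_Integration.integral_cong refl) (auto simp: circle_measure.space_circle)
    moreover have "continuous_on (sphere 0 1) f = continuous_on (sphere 0 1) g"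
      using that by (intro continuous_on_cong) auto
    ultimately show ?thesis using that(1) assms(1,2) by (auto simp: A_def)
  qed
  \<comment> \<open>Keeping \<open>f\<close> arbitrary in the induction lets the product case apply
    its two hypotheses one after the other.\<close>
  have A_mult: "(\<lambda>t. of_real (p t) * f t) \<in> A" if "real_polynomial_function p" "f \<in> A" for p f
    using that
  proof (induction p arbitrary: f rule: real_polynomial_function.induct)
    case (linear p)
    interpret bounded_linear p by fact
    \<comment> \<open>With this \<open>a\<close>, real linearity gives p t = 2 Re (a t) = a t + cnj
      a * cnj t, and cnj t = 1 / t on the circle turns multiplication by \<open>p\<close> into two
      shifts.\<close>
    define a where "a = Complex (p 1 / 2) (- p \<i> / 2)"
    have "complex_of_real (p t) * f t = a * (t powi 1 * f t) + cnj a * (t powi (-1) * f t)"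
      if "t \<in> sphere 0 1" for t
    proof -
      have "p t = p (Re t *\<^sub>R 1 + Im t *\<^sub>R \<i>)"
        by (intro arg_cong[where f=p]) (simp add: complex_eq_iff)
      also have "\<dots> = Re t * p 1 + Im t * p \<i>"
        by (simp add: add scaleR)
      finally have "complex_of_real (p t) = a * t + cnj a * cnj t"
        by (simp add: a_def complex_eq_iff field_simps)
      with that show ?thesis by (simp add: cnj_inverse algebra_simps)
    qed
    then show ?case
      by (intro A_cong[OF A_add[OF A_scale[OF A_shift[OF linear.prems]] A_scale[OF A_shift[OF linear.prems]]]])
  next
    case (const c)
    then show ?case by (rule A_scale)
  next
    case (add p q)
    then show ?case by (simp add: A_add distrib_right)
  next
    case (mult p q)
    then show ?case by (simp add: mult.assoc)
  qed
  have poly: "(LINT t|\<mu>. p t) = (LINT t|\<nu>. p t)" if "real_polynomial_function p" for p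
  proof -
    have "(\<lambda>t. 1) \<in> A" using moments_powi by (simp add: A_def)
    from A_mult[OF that this] have "(LINT t|\<mu>. complex_of_real (p t)) = (LINT t|\<nu>. complex_of_real (p t))"
      unfolding A_def by (auto dest: spec[where x=0])
    then show ?thesis by simp
  qed
  \<comment> \<open>A polynomial uniformly within e / 2 of \<open>f\<close> changes each integral by
    at most e / 2, since both measures have mass 1.\<close>
  have cont: "(LINT t|\<mu>. f t) = (LINT t|\<nu>. f t)"
    if f: "continuous_on (sphere 0 1) f" for f :: "complex \<Rightarrow> real"
  proof -
    have "\<bar>(LINT t|\<mu>. f t) - (LINT t|\<nu>. f t)\<bar> \<le> e" if "e > 0" for e
    proof -
      obtain p where p: "real_polynomial_function p" "\<And>t. t \<in> sphere 0 1 \<Longrightarrow> \<bar>f t - p t\<bar> < e / 2"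
        using Stone_Weierstrass_real_polynomial_function[of "sphere 0 1" f "e / 2"] f \<open>e > 0\<close>
        by auto
      have pc: "continuous_on (sphere 0 1) p"
        using p(1) by (simp add: continuous_on_polymonial_function real_polynomial_function_eq)
      have close: "\<bar>(LINT t|N. f t) - (LINT t|N. p t)\<bar> \<le> e / 2" if "circle_measure N" for N
      proof -
        interpret N: circle_measure N by fact
        have "\<bar>(LINT t|N. f t) - (LINT t|N. p t)\<bar> = \<bar>LINT t|N. f t - p t\<bar>"
          using f pc by (simp add: N.integrable_circle)
        also have "\<dots> \<le> (LINT t|N. \<bar>f t - p t\<bar>)"
          by (rule integral_abs_bound)
        also have "\<dots> \<le> (LINT t|N. e / 2)"
          using p(2) f pc
          by (intro integral_mono N.integrable_circle continuous_intros) (auto intro: less_imp_le)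
        finally show ?thesis by (simp add: N.prob_space[simplified])
      qed
      show ?thesis
        using close[OF assms(1)] close[OF assms(2)] poly[OF p(1)] by linarith
    qed
    then show ?thesis
      by (metis abs_le_zero_iff field_le_epsilon add_0 eq_iff_diff_eq_0)
  qed
  have sphere_borel: "sphere 0 1 \<in> sets (borel :: complex measure)"
    by (simp add: borel_closed)
  have sets_borel: "X \<in> sets borel" if "X \<in> sets \<mu>" for X
    using that sphere_borel by (auto simp: \<mu>.sets_circle sets_restrict_space)
  have closed_eq: "measure \<mu> (C \<inter> sphere 0 1) = measure \<nu> (C \<inter> sphere 0 1)" if "closed C" for C
  proof (cases "C = {}")
    case False
    \<comment> \<open>For n > 0 this equals 1 on \<open>C\<close> and 0 at distance at least 1/n, so
      it tends pointwise to the indicator of \<open>C\<close>. The case of empty \<open>C\<close> is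
      split off because \<open>infdist\<close> to the empty set is 0 by convention.\<close>
    define f where "f n t = max 0 (1 - real n * infdist t C)" for n t
    have f_cont: "continuous_on X (f n)" for X n
      unfolding f_def by (intro continuous_intros)
    have lim: "(\<lambda>n. f n t) \<longlonglongrightarrow> indicator C t" for t
    proof (cases "t \<in> C")
      case True
      then show ?thesis by (simp add: f_def)
    next
      case nin: False
      then have pos: "infdist t C > 0"
        using False \<open>closed C\<close> infdist_pos_not_in_closed by blast
      obtain N where N: "1 < real N * infdist t C"
        using pos reals_Archimedean3 by blast
      have "f n t = 0" if "n \<ge> N" for n
      proof -
        have "real N * infdist t C \<le> real n * infdist t C"
          using that pos by (intro mult_right_mono) auto
        with N show ?thesis by (simp add: f_def)
      qed
      then have "\<forall>\<^sub>F n in sequentially. f n t = 0"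
        by (auto simp: eventually_sequentially)
      then show ?thesis using nin by (simp add: tendsto_eventually)
    qed
    have conv: "(\<lambda>n. LINT t|N. f n t) \<longlonglongrightarrow> measure N (C \<inter> sphere 0 1)"
      if "circle_measure N" for N
    proof -
      interpret N: circle_measure N by fact
      have "(\<lambda>n. LINT t|N. f n t) \<longlonglongrightarrow> (LINT t|N. indicator C t)"
      proof (rule integral_dominated_convergence[where w="\<lambda>_. 1"])
        have "sphere 0 1 \<inter> C \<in> sets N"
          unfolding N.sets_circle sets_restrict_space using \<open>closed C\<close> by (intro imageI) simp
        then show "(indicator C :: complex \<Rightarrow> real) \<in> borel_measurable N"
          by (simp add: borel_measurable_indicator_iff Int_commute)
      qed (auto intro!: N.borel_measurable_circle f_cont AE_I2 lim, auto simp: f_def infdist_nonneg)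
      then show ?thesis by simp
    qed
    from conv[OF assms(2)] have "(\<lambda>n. LINT t|\<mu>. f n t) \<longlonglongrightarrow> measure \<nu> (C \<inter> sphere 0 1)"
      by (simp add: cont[OF f_cont])
    with conv[OF assms(1)] show ?thesis
      by (rule LIMSEQ_unique)
  qed simp
  have id: "(\<lambda>t. t) \<in> borel_measurable \<mu>" "(\<lambda>t. t) \<in> borel_measurable \<nu>"
    by (intro \<mu>.borel_measurable_circle \<nu>.borel_measurable_circle continuous_intros)+
  \<comment> \<open>Pushed forward to the whole plane, the measures can be compared on closed sets,
    an intersection-stable generator of the Borel sets.\<close>
  have distr: "distr \<mu> borel (\<lambda>t. t) = distr \<nu> borel (\<lambda>t. t)"
  proof (rule measure_eqI_generator_eq[where E="Collect closed" and \<Omega>=UNIV and A="\<lambda>_. UNIV"])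
    show "emeasure (distr \<mu> borel (\<lambda>t. t)) X = emeasure (distr \<nu> borel (\<lambda>t. t)) X"
      if "X \<in> Collect closed" for X
      using that closed_eq[of X] id
      by (simp add: emeasure_distr borel_closed \<mu>.emeasure_eq_measure \<nu>.emeasure_eq_measure)
  qed (use id in \<open>auto simp: Int_stable_def borel_eq_closed emeasure_distr\<close>)
  show ?thesis
  proof (rule measure_eqI)
    show "sets \<mu> = sets \<nu>" by (simp add: \<mu>.sets_circle \<nu>.sets_circle)
    fix X assume X: "X \<in> sets \<mu>"
    then have "X \<subseteq> sphere 0 1" using sets.sets_into_space by fastforce
    then show "emeasure \<mu> X = emeasure \<nu> X"
      using arg_cong[OF distr, of "\<lambda>M. emeasure M X"] sets_borel[OF X] id
      by (simp add: emeasure_distr Int_absorb2)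
  qed
qed

text \<open>\<open>psi\<close> is recovered from \<open>eta\<close> by a Moebius map, and the
  moments are the Taylor coefficients of 1 + \<open>psi\<close>.\<close>

lemma eta_determines_measure:
  assumes "circle_measure \<mu>" "circle_measure \<nu>"
    and eq: "\<And>z. z \<in> ball 0 1 \<Longrightarrow> eta \<mu> z = eta \<nu> z"
  shows "\<mu> = \<nu>"
proof (rule circle_measure_eqI[OF assms(1,2)])
  fix n
  let ?a = "\<lambda>n. LINT t|\<mu>. t ^ n" and ?b = "\<lambda>n. LINT t|\<nu>. t ^ n"
  have "(\<lambda>n. (?a n - ?b n) * z ^ n) sums 0" if "z \<in> ball 0 1" for z
  proof -
    have "psi \<mu> z = psi \<nu> z"
      using assms that by (simp add: circle_measure.psi_eq_eta)
    with sums_diff[OF circle_measure.moment_series_sums[OF assms(1) that]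
        circle_measure.moment_series_sums[OF assms(2) that]]
    show ?thesis by (simp add: left_diff_distrib)
  qed
  note sums_0 = this
  have "?a n - ?b n = 0"
  proof (cases "n = 0")
    case True
    with assms(1,2) show ?thesis
      by (simp add: circle_measure_def prob_space.prob_space)
  next
    case False
    show ?thesis
    proof (rule ccontr)
      assume "?a n - ?b n \<noteq> 0"
      \<comment> \<open>A nonzero coefficient of positive index would keep the sum away from 0 on a
        punctured disc, but the sum is the zero function. Index 0 is settled above by the total
        mass.\<close>
      with False sums_0 obtain s :: real
        where "0 < s" "\<And>z :: complex. z \<in> cball 0 s - {0} \<Longrightarrow> (0 :: complex) \<noteq> 0"
        using powser_0_nonzero[of 1 0 "\<lambda>n. ?a n - ?b n" "\<lambda>_. 0" n] by auto
      from this(1) this(2)[of "of_real s"] show False by simp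
    qed
  qed
  then show "?a n = ?b n" by simp
qed

section \<open>Existence: Poisson approximants and the Herglotz representation\<close>

text \<open>Cauchy's formula for the n-th derivative, written out on the circle of radius
  \<open>r\<close>.\<close>

lemma circle_coefficient_integral:
  assumes f: "f holomorphic_on ball 0 1" and r: "0 < r" "r < 1"
  shows "((\<lambda>s. f (of_real r * cis (2 * pi * s)) * cis (- (2 * pi * s)) ^ n)
      has_integral of_real r ^ n * ((deriv ^^ n) f 0 / fact n)) {0..1}"
proof -
  \<comment> \<open>The scaling cancels 2 \<pi> i and the factor r^(-n) left by the kernel and the
    derivative of the path.\<close>
  define C where "C = of_real r ^ n / (2 * of_real pi * \<i>)"
  have "((\<lambda>u. f u / (u - 0) ^ Suc n) has_contour_integral
      (2 * pi * \<i> / fact n * (deriv ^^ n) f 0)) (circlepath 0 r)"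
  proof (rule Cauchy_has_contour_integral_higher_derivative_circlepath)
    show "continuous_on (cball 0 r) f"
      using r by (intro holomorphic_on_imp_continuous_on holomorphic_on_subset[OF f]) auto
    show "f holomorphic_on ball 0 r"
      using r by (intro holomorphic_on_subset[OF f]) auto
  qed (use r in auto)
  then have "((\<lambda>s. C * (f (circlepath 0 r s) / (circlepath 0 r s) ^ Suc n *
      vector_derivative (circlepath 0 r) (at s)))
      has_integral C * (2 * pi * \<i> / fact n * (deriv ^^ n) f 0)) {0..1}"
    unfolding has_contour_integral by (intro has_integral_mult_right) simp
  moreover have "C * (2 * pi * \<i> / fact n * (deriv ^^ n) f 0) =
      of_real r ^ n * ((deriv ^^ n) f 0 / fact n)"
    by (simp add: C_def mult.left_commute[of _ \<i>])
  moreover have "C * (f (circlepath 0 r s) / (circlepath 0 r s) ^ Suc n *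
      vector_derivative (circlepath 0 r) (at s)) =
      f (of_real r * cis (2 * pi * s)) * cis (- (2 * pi * s)) ^ n" for s
  proof -
    have "circlepath 0 r s = of_real r * cis (2 * pi * s)"
      by (simp add: circlepath cis_conv_exp mult_ac)
    moreover have "vector_derivative (circlepath 0 r) (at s) =
        2 * of_real pi * \<i> * (of_real r * cis (2 * pi * s))"
      by (simp add: vector_derivative_circlepath cis_conv_exp mult_ac)
    moreover have "cis (- (2 * pi * s)) = inverse (cis (2 * pi * s))"
      by simp
    ultimately show ?thesis
      using r by (simp only: C_def) (simp add: field_simps del: cis_inverse)
  qed
  ultimately show ?thesis by (simp only:)
qed

text \<open>The mean value property of g z^n. Conjugated, it shows that cnj g contributes only to
  the moment of order 0.\<close>

lemma circle_integral_mult_power: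
  assumes g: "g holomorphic_on ball 0 1" and r: "0 < r" "r < 1"
  shows "((\<lambda>s. g (of_real r * cis (2 * pi * s)) * (of_real r * cis (2 * pi * s)) ^ n)
      has_integral (if n = 0 then g 0 else 0)) {0..1}"
proof -
  have "(\<lambda>z. g z * z ^ n) holomorphic_on ball 0 1"
    by (intro holomorphic_intros g)
  from circle_coefficient_integral[OF this r, of 0] show ?thesis
    by (cases "n = 0") (simp_all add: power_0_left)
qed

text \<open>
  The Poisson approximants of the representing measure, parametrised by \<open>s \<in> [0, 1]\<close> with
  \<open>t = exp (- 2 \<pi> \<i> s)\<close>.
\<close>

lemma poisson_distribution:
  assumes g: "g holomorphic_on ball 0 1" "g 0 = 1"
    and Re_g: "\<And>z. z \<in> ball 0 1 \<Longrightarrow> 0 \<le> Re (g z)"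
    and r: "0 < r" "r < 1"
  obtains P where "real_distribution P" "measure P {-1<..1} = 1"
    "\<And>n. (LINT s|P. cis (- (2 * pi * s)) ^ n) =
      (of_real r ^ n * ((deriv ^^ n) g 0 / fact n) + (if n = 0 then 1 else 0)) / 2"
proof
  define w where "w s = of_real r * cis (2 * pi * s)" for s
  define D where "D s = indicator {0..1} s * Re (g (w s))" for s :: real
  define P where "P = density lborel D"
  have w: "w s \<in> ball 0 1" for s
    using r by (simp add: w_def norm_mult)
  have gw: "continuous_on X (\<lambda>s. g (w s))" for X
    by (rule continuous_on_compose2[OF holomorphic_on_imp_continuous_on[OF g(1)]])
       (use w in \<open>auto simp: w_def intro!: continuous_intros\<close>)
  \<comment> \<open>Split Re g into (g + cnj g) / 2: the first half yields the Taylor coefficient,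
    the second only the constant term.\<close>
  have moment: "((\<lambda>s. Re (g (w s)) *\<^sub>R cis (- (2 * pi * s)) ^ n) has_integral
      (of_real r ^ n * ((deriv ^^ n) g 0 / fact n) + (if n = 0 then 1 else 0)) / 2) {0..1}" for n
  proof -
    have "((\<lambda>s. cnj (g (w s) * (w s) ^ n)) has_integral (if n = 0 then 1 else 0)) {0..1}"
      using circle_integral_mult_power[OF g(1) r, of n] unfolding w_def[symmetric] g(2)
      by (subst (asm) has_integral_cnj[symmetric]) (simp add: o_def if_distrib cong: if_cong)
    \<comment> \<open>Dividing by r^n removes the radius from the power and leaves the right-hand
      side alone, which is nonzero only for n = 0.\<close>
    from has_integral_mult_right[OF this, of "1 / of_real r ^ n"]
    have "((\<lambda>s. 1 / of_real r ^ n * cnj (g (w s) * (w s) ^ n)) has_integral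
        (if n = 0 then 1 else 0)) {0..1}"
      by (simp add: if_distrib cong: if_cong)
    also have "(\<lambda>s. 1 / of_real r ^ n * cnj (g (w s) * (w s) ^ n)) =
        (\<lambda>s. cnj (g (w s)) * cis (- (2 * pi * s)) ^ n)"
      using r by (auto simp: w_def power_mult_distrib cis_cnj)
    finally have 1: "((\<lambda>s. cnj (g (w s)) * cis (- (2 * pi * s)) ^ n) has_integral
        (if n = 0 then 1 else 0)) {0..1}" .
    have 2: "(g u + cnj (g u)) / 2 = of_real (Re (g u))" for u
      by (simp add: complex_eq_iff)
    show ?thesis
      using has_integral_divide[OF has_integral_add[OF circle_coefficient_integral[OF g(1) r, of n] 1], of 2]
      by (simp add: w_def scaleR_conv_of_real flip: 2 distrib_right)
  qed
  have int: "set_integrable lborel {0..1} (\<lambda>s. Re (g (w s)) *\<^sub>R f s)"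
    if "continuous_on {0..1} f" for f :: "real \<Rightarrow> 'a::euclidean_space"
    by (intro borel_integrable_atLeastAtMost' continuous_intros gw that)
  have D_int: "integrable lborel D"
    using int[of "\<lambda>_. 1 :: real"] by (simp add: set_integrable_def D_def[abs_def])
  then have [measurable]: "D \<in> borel_measurable borel" by simp
  have D_nonneg: "0 \<le> D s" for s
    using Re_g[OF w] by (simp add: D_def)
  have LINT: "(LINT s|P. f s) = integral {0..1} (\<lambda>s. Re (g (w s)) *\<^sub>R f s)"
    if "continuous_on UNIV f" for f :: "real \<Rightarrow> complex"
  proof -
    have "(LINT s|P. f s) = (LINT s|lborel. D s *\<^sub>R f s)"
      unfolding P_def using D_nonneg borel_measurable_continuous_onI[OF that]
      by (intro integral_density) auto
    also have "\<dots> = (LINT s:{0..1}|lborel. Re (g (w s)) *\<^sub>R f s)"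
      by (simp add: set_lebesgue_integral_def D_def)
    also have "\<dots> = integral {0..1} (\<lambda>s. Re (g (w s)) *\<^sub>R f s)"
      by (intro set_borel_integral_eq_integral(2) int continuous_on_subset[OF that]) auto
    finally show ?thesis .
  qed
  show *: "(LINT s|P. cis (- (2 * pi * s)) ^ n) =
      (of_real r ^ n * ((deriv ^^ n) g 0 / fact n) + (if n = 0 then 1 else 0)) / 2" for n
    by (subst LINT) (intro continuous_intros, rule integral_unique[OF moment])
  \<comment> \<open>The total mass is the moment of order 0, namely (g 0 + 1) / 2.\<close>
  have "(LINT s|lborel. D s) = 1"
  proof -
    have "complex_of_real (LINT s|lborel. D s) = (LINT s|lborel. D s *\<^sub>R 1)"
      by (simp add: scaleR_conv_of_real)
    also have "\<dots> = (LINT s|P. 1)"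
      unfolding P_def using D_nonneg by (intro integral_density[symmetric]) auto
    finally show ?thesis using *[of 0] g(2) by simp
  qed
  then have D1: "(\<integral>\<^sup>+s. ennreal (D s) \<partial>lborel) = 1"
    by (subst nn_integral_eq_integral) (use D_int D_nonneg in auto)
  then interpret P: prob_space P
    by (intro prob_spaceI) (simp add: P_def emeasure_density)
  show "real_distribution P"
    by unfold_locales (simp add: P_def)
  \<comment> \<open>The density is supported in [0, 1]; the half-open interval around it has the
    shape used in the definition of tightness.\<close>
  have "emeasure P {-1<..1} = (\<integral>\<^sup>+s. ennreal (D s) \<partial>lborel)"
  proof -
    have "ennreal (D s) * indicator {-1<..1} s = ennreal (D s)" for s
      by (simp add: D_def split: split_indicator)
    then show ?thesis
      unfolding P_def by (subst emeasure_density) simp_all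
  qed
  then show "measure P {-1<..1} = 1"
    by (simp add: D1 measure_def)
qed

text \<open>All approximants live on one bounded interval, so they are tight and a subsequence
  converges weakly on the line; the limit is then wrapped around the circle.\<close>

theorem herglotz_representation:
  assumes g: "g holomorphic_on ball 0 1" "g 0 = 1"
    and Re_g: "\<And>z. z \<in> ball 0 1 \<Longrightarrow> 0 \<le> Re (g z)"
  obtains \<mu> where "circle_measure \<mu>"
    "\<And>z. z \<in> ball 0 1 \<Longrightarrow> psi \<mu> z = (g z - 1) / 2"
proof -
  define c where "c n = (deriv ^^ n) g 0 / fact n" for n
  \<comment> \<open>Radii increasing to 1; the shift by 2 makes the first one 1/2 rather than 0 or
    undefined.\<close>
  define r where "r k = 1 - 1 / real (k + 2)" for k
  define e where "e s = cis (- (2 * pi * s))" for s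
  have r: "0 < r k" "r k < 1" for k
    by (simp_all add: r_def field_simps)
  have r_lim: "r \<longlonglongrightarrow> 1"
    unfolding r_def by real_asymp
  have "\<exists>P. real_distribution P \<and> measure P {-1<..1} = 1 \<and>
      (\<forall>n. (LINT s|P. e s ^ n) = (of_real (r k) ^ n * c n + (if n = 0 then 1 else 0)) / 2)" for k
    using poisson_distribution[OF g Re_g r, of k] unfolding c_def e_def by metis
  then obtain P where P: "\<And>k. real_distribution (P k)" "\<And>k. measure (P k) {-1<..1} = 1"
    "\<And>k n. (LINT s|P k. e s ^ n) = (of_real (r k) ^ n * c n + (if n = 0 then 1 else 0)) / 2"
    by metis
  have "tight P"
    unfolding tight_def
  proof (intro conjI allI impI)
    show "\<exists>a b. a < b \<and> (\<forall>n. 1 - \<epsilon> < measure (P n) {a<..b})" if "0 < \<epsilon>" for \<epsilon> :: real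
      using that P(2) by (intro exI[of _ "-1"] exI[of _ "1 :: real"]) simp
  qed (rule P(1))
  from tight_imp_convergent_subsubsequence[OF this strict_mono_id] obtain q Q
    where q: "strict_mono q" and Q: "real_distribution Q" and "weak_conv_m (P \<circ> id \<circ> q) Q"
    by metis
  then have conv: "weak_conv_m (\<lambda>k. P (q k)) Q" by (simp add: o_def)
  have e_norm: "norm (e s) = 1" for s
    by (simp add: e_def)
  have e_cont: "isCont e s" for s
    unfolding e_def[abs_def] cis_conv_exp by (intro continuous_intros)
  interpret Q: real_distribution Q by fact
  have Q_moment: "(LINT s|Q. e s ^ n) = (c n + (if n = 0 then 1 else 0)) / 2" for n
  proof (rule LIMSEQ_unique)
    \<comment> \<open>Powers of \<open>e\<close> are continuous and bounded by 1, so weak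
      convergence carries their integrals to the limit.\<close>
    show "(\<lambda>k. LINT s|P (q k). e s ^ n) \<longlonglongrightarrow> (LINT s|Q. e s ^ n)"
      by (rule weak_conv_imp_integral_bdd_continuous_conv[where B=1])
         (use P(1) Q conv e_cont e_norm in \<open>auto simp: norm_power intro!: continuous_intros\<close>)
    have "(\<lambda>k. r (q k)) \<longlonglongrightarrow> 1"
      using LIMSEQ_subseq_LIMSEQ[OF r_lim q] by (simp add: o_def)
    then have "(\<lambda>k. (of_real (r (q k)) ^ n * c n + (if n = 0 then 1 else 0)) / 2) \<longlonglongrightarrow>
        (of_real 1 ^ n * c n + (if n = 0 then 1 else 0)) / 2"
      by (intro tendsto_intros) auto
    then show "(\<lambda>k. LINT s|P (q k). e s ^ n) \<longlonglongrightarrow> (c n + (if n = 0 then 1 else 0)) / 2"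
      by (simp add: P(3))
  qed
  \<comment> \<open>\<open>e\<close> maps the whole line into the circle, so the image measure lives
    there wherever \<open>Q\<close> puts its mass.\<close>
  define \<mu> where "\<mu> = distr Q (restrict_space borel (sphere 0 1)) e"
  have e: "e \<in> measurable Q (restrict_space borel (sphere 0 1))"
  proof (rule measurable_restrict_space2)
    show "e \<in> borel_measurable Q"
      using borel_measurable_continuous_onI[of e] e_cont
      by (simp add: continuous_on_eq_continuous_within)
  qed (simp add: e_norm)
  have \<mu>: "circle_measure \<mu>"
    unfolding \<mu>_def circle_measure_def circle_measure_axioms_def
    using Q.prob_space_distr[OF e] by simp
  interpret \<mu>: circle_measure \<mu> by (rule \<mu>)
  have "psi \<mu> z = (g z - 1) / 2" if z: "z \<in> ball 0 1" for z
  proof -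
    have "(LINT t|\<mu>. t ^ n) = (c n + (if n = 0 then 1 else 0)) / 2" for n
      unfolding \<mu>_def
      by (subst integral_distr[OF e])
         (auto simp: Q_moment intro!: borel_measurable_continuous_on_restrict continuous_intros)
    with \<mu>.moment_series_sums[OF z]
    have "(\<lambda>n. (c n + (if n = 0 then 1 else 0)) / 2 * z ^ n) sums (1 + psi \<mu> z)" by simp
    moreover have "(\<lambda>n. (c n * z ^ n + (if n = 0 then 1 else 0)) / 2) sums ((g z + 1) / 2)"
      using holomorphic_power_series[OF g(1) z] sums_single[of 0 "\<lambda>_. 1"]
      by (intro sums_divide sums_add) (auto simp: c_def)
    then have "(\<lambda>n. (c n + (if n = 0 then 1 else 0)) / 2 * z ^ n) sums ((g z + 1) / 2)"
      by (rule back_subst[of "\<lambda>f. f sums _"]) (auto simp: fun_eq_iff)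
    ultimately have "1 + psi \<mu> z = (g z + 1) / 2" by (rule sums_unique2)
    then show ?thesis by (simp add: field_simps)
  qed
  with \<mu> show thesis by (rule that)
qed

section \<open>Measures with prescribed \<open>eta\<close>, and the convolution\<close>

text \<open>The Cayley transform \<open>g\<close> of \<open>F\<close> maps into the right
  half-plane. Its Herglotz measure has \<open>psi\<close> = (g - 1) / 2 = F / (1 - F), which is
  equivalent to \<open>eta\<close> = F.\<close>

lemma exists_measure_with_eta:
  assumes F: "F holomorphic_on ball 0 1" "F 0 = 0"
    and F_less: "\<And>z. z \<in> ball 0 1 \<Longrightarrow> norm (F z) < 1"
  obtains \<mu> where "circle_measure \<mu>" "\<And>z. z \<in> ball 0 1 \<Longrightarrow> eta \<mu> z = F z"
proof -
  define g where "g z = (1 + F z) / (1 - F z)" for z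
  have nz: "1 - F z \<noteq> 0" if "z \<in> ball 0 1" for z
    using F_less[OF that] by auto
  have "0 \<le> Re (g z)" if "z \<in> ball 0 1" for z
  proof -
    have "(Re (F z))\<^sup>2 + (Im (F z))\<^sup>2 < 1"
      using F_less[OF that] by (metis cmod_power2 norm_ge_zero one_power2 power_strict_mono zero_less_numeral)
    then show ?thesis
      unfolding g_def Re_divide
      by (intro divide_nonneg_nonneg) (simp add: power2_eq_square algebra_simps, simp)
  qed
  moreover have "g holomorphic_on ball 0 1"
    unfolding g_def by (intro holomorphic_intros F nz)
  moreover have "g 0 = 1" by (simp add: g_def F(2))
  ultimately obtain \<mu> where \<mu>: "circle_measure \<mu>"
    "\<And>z. z \<in> ball 0 1 \<Longrightarrow> psi \<mu> z = (g z - 1) / 2"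
    using herglotz_representation by blast
  have "eta \<mu> z = F z" if "z \<in> ball 0 1" for z
    using nz[OF that] unfolding eta_def \<mu>(2)[OF that] g_def
    by (simp add: field_simps)
  with \<mu>(1) show thesis by (rule that)
qed

theorem proposition5p2:
  fixes \<mu>1 \<mu>2 :: "complex measure"
  assumes "circle_prob \<mu>1" and "circle_prob \<mu>2"
  shows "\<exists>!\<mu>. circle_prob \<mu> \<and>
           (\<forall>z\<in>ball 0 1. eta \<mu> z = z * eta_quot \<mu>1 (eta \<mu>2 z))"
proof -
  interpret \<mu>1: circle_measure \<mu>1 using assms(1) by (simp add: circle_prob_iff)
  interpret \<mu>2: circle_measure \<mu>2 using assms(2) by (simp add: circle_prob_iff)
  define F where "F z = z * eta_quot \<mu>1 (eta \<mu>2 z)" for z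
  have eta2: "eta \<mu>2 z \<in> ball 0 1" if "z \<in> ball 0 1" for z
    using \<mu>2.norm_eta_less_1[OF that] by simp
  have "norm (F z) < 1" if "z \<in> ball 0 1" for z
  proof -
    \<comment> \<open>The quotient may have modulus 1; strictness comes from the factor z, which
      also gives F 0 = 0.\<close>
    have "norm (F z) \<le> norm z * 1"
      unfolding F_def norm_mult by (intro mult_left_mono \<mu>1.norm_eta_quot_le_1 eta2 that) simp
    with that show ?thesis by simp
  qed
  \<comment> \<open>Since \<open>eta_quot\<close> is holomorphic at 0 too, the composition stays
    holomorphic at every zero of \<open>eta \<mu>2\<close>.\<close>
  moreover have "(\<lambda>z. eta_quot \<mu>1 (eta \<mu>2 z)) holomorphic_on ball 0 1"
    using holomorphic_on_compose_gen[OF \<mu>2.eta_holomorphic \<mu>1.eta_quot_holomorphic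
        image_subsetI[OF eta2]]
    by (simp add: o_def)
  then have "F holomorphic_on ball 0 1"
    unfolding F_def by (intro holomorphic_intros)
  ultimately obtain \<mu> where "circle_measure \<mu>" "\<And>z. z \<in> ball 0 1 \<Longrightarrow> eta \<mu> z = F z"
    using exists_measure_with_eta[of F] by (auto simp: F_def)
  then show ?thesis
    using eta_determines_measure by (intro ex1I[of _ \<mu>]) (auto simp: circle_prob_iff F_def)
qed

end
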